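(* Let $n,k$ be integers with $k\geq 1$ and $n\geq k+4$, and let $\mathcal{D}_{n,k}$ be the set of strongly connected digraphs of order $n$ with essential connectivity $k$. Then the digraphs $\vec{G}_n^{k,2}$ and $\vec{G}_n^{k,n-k-2}$ maximize the spectral radius among all digraphs in $\mathcal{D}_{n,k}$; that is, both belong to $\mathcal{D}_{n,k}$ and $\rho(D)\leq \rho(\vec{G}_n^{k,2})=\rho(\vec{G}_n^{k,n-k-2})$ for every $D\in\mathcal{D}_{n,k}$.
   Context: Digraphs are finite, without loops and without multiple arcs (a pair of opposite arcs $uv$ and $vu$ is allowed). For a digraph $D$ with vertices $v_1,\dots,v_n$, the adjacency matrix is $A(D)=(a_{ij})$ with $a_{ij}=1$ if $v_iv_j$ is an arc from $v_i$ to $v_j$ and $a_{ij}=0$ otherwise; $\rho(D)$ denotes the spectral radius of $A(D)$ (its largest, i.e. Perron, eigenvalue). A digraph is strongly connected if for every pair of vertices $u,v$ there are directed paths from $u$ to $v$ and from $v$ to $u$. A strongly connected component is non-trivial if it has more than one vertex. The essential connectivity $\kappa'(D)$ of a strongly connected digraph $D$ is the minimum number of vertices whose removal produces a digraph with at least two non-trivial strongly connected components (the resulting digraph may also have trivial strongly connected components). The set $\mathcal{D}_{n,k}$ consists of the strongly connected digraphs $D$ on $n$ vertices for which $\kappa'(D)=k$. $\vec{K}_m$ is the complete digraph on $m$ vertices (both arcs between every pair of distinct vertices). For disjoint digraphs $D_1,D_2$, $D_1\cup D_2$ is their disjoint union, and $D_1\nabla D_2$ is the digraph with vertex set $V(D_1)\cup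 V(D_2)$ and arc set $E(D_1)\cup E(D_2)\cup\{uv,vu \mid u\in V(D_1), v\in V(D_2)\}$. For $2\leq m\leq n-k-2$, $\vec{G}_n^{k,m}$ is the digraph obtained from $\vec{K}_k\nabla(\vec{K}_m\cup\vec{K}_{n-k-m})$ by adding all arcs $vu$ (from $v$ to $u$) with $v\in V(\vec{K}_m)$ and $u\in V(\vec{K}_{n-k-m})$. *)

theory Defs
  imports
    "Graph_Theory.Digraph_Component"
    "Jordan_Normal_Form.Spectral_Radius"
    "HOL-Library.Extended_Nat"
begin

definition adjacency_matrix :: "('a, 'b) pre_digraph \<Rightarrow> 'a list \<Rightarrow> complex mat" where
  "adjacency_matrix D vs =
     mat (length vs) (length vs) (\<lambda>(i, j). if vs ! i \<rightarrow>\<^bsub>D\<^esub> vs ! j then 1 else 0)"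

lemma eigenvalue_adjacency_matrix_iff:
  assumes "distinct vs"
  shows "eigenvalue (adjacency_matrix D vs) c \<longleftrightarrow>
    (\<exists>f. (\<exists>x\<in>set vs. f x \<noteq> 0) \<and>
         (\<forall>x\<in>set vs. (\<Sum>y\<in>set vs. if x \<rightarrow>\<^bsub>D\<^esub> y then f y else 0) = c * f x))"
    (is "?L \<longleftrightarrow> ?R")
proof -
  let ?n = "length vs" and ?A = "adjacency_matrix D vs"
  have bij: "bij_betw ((!) vs) {0..<?n} (set vs)"
    using bij_betw_nth[OF assms, of "{0..<?n}" "set vs"] by (simp add: lessThan_atLeast0)
  have mv: "(?A *\<^sub>v v) $ i = (\<Sum>y\<in>set vs. if vs ! i \<rightarrow>\<^bsub>D\<^esub> y then f y else 0)"
    if v: "v = vec ?n (\<lambda>i. f (vs ! i))" and i: "i < ?n" for v f i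
  proof -
    have "(?A *\<^sub>v v) $ i = (\<Sum>j\<in>{0..<?n}. if vs ! i \<rightarrow>\<^bsub>D\<^esub> vs ! j then f (vs ! j) else 0)"
      using i unfolding v adjacency_matrix_def
      by (auto simp: scalar_prod_def intro!: sum.cong)
    also have "\<dots> = (\<Sum>y\<in>set vs. if vs ! i \<rightarrow>\<^bsub>D\<^esub> y then f y else 0)"
      by (rule sum.reindex_bij_betw[OF bij])
    finally show ?thesis .
  qed
  show ?thesis
  proof
    assume ?L
    then obtain v where v: "v \<in> carrier_vec ?n" "v \<noteq> 0\<^sub>v ?n" "?A *\<^sub>v v = c \<cdot>\<^sub>v v"
      by (auto simp: eigenvalue_def eigenvector_def adjacency_matrix_def)
    define f where "f = (\<lambda>x. v $ (the_inv_into {0..<?n} ((!) vs) x))"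
    have f: "f (vs ! i) = v $ i" if "i < ?n" for i
      using that bij unfolding f_def
      by (subst the_inv_into_f_f) (auto simp: bij_betw_def)
    have vf: "v = vec ?n (\<lambda>i. f (vs ! i))"
      using v(1) f by auto
    from v(1,2) obtain i where "i < ?n" "v $ i \<noteq> 0"
      by (metis carrier_vecD eq_vecI index_zero_vec)
    then have "\<exists>x\<in>set vs. f x \<noteq> 0"
      using f by (metis nth_mem)
    moreover have "(\<Sum>y\<in>set vs. if x \<rightarrow>\<^bsub>D\<^esub> y then f y else 0) = c * f x" if x: "x \<in> set vs" for x
    proof -
      obtain i where i: "i < ?n" "x = vs ! i" using x by (metis in_set_conv_nth)
      show ?thesis using mv[OF vf i(1)] v(1,3) f[OF i(1)] i by simp
    qed
    ultimately show ?R by blast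
  next
    assume ?R
    then obtain f where f: "\<exists>x\<in>set vs. f x \<noteq> 0"
      "\<And>x. x \<in> set vs \<Longrightarrow> (\<Sum>y\<in>set vs. if x \<rightarrow>\<^bsub>D\<^esub> y then f y else 0) = c * f x" by blast
    define v where "v = vec ?n (\<lambda>i. f (vs ! i))"
    from f(1) obtain i where "i < ?n" "f (vs ! i) \<noteq> 0" by (metis in_set_conv_nth)
    then have "v $ i \<noteq> 0\<^sub>v ?n $ i" by (simp add: v_def)
    then have "v \<noteq> 0\<^sub>v ?n" by auto
    moreover have "?A *\<^sub>v v = c \<cdot>\<^sub>v v"
    proof (rule eq_vecI)
      fix i assume "i < dim_vec (c \<cdot>\<^sub>v v)"
      then have i: "i < ?n" by (simp add: v_def)
      show "(?A *\<^sub>v v) $ i = (c \<cdot>\<^sub>v v) $ i"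
        using mv[OF v_def i] f(2)[of "vs ! i"] i by (simp add: v_def)
    qed (simp add: v_def adjacency_matrix_def)
    moreover have "v \<in> carrier_vec ?n" "dim_row ?A = ?n"
      by (simp_all add: v_def adjacency_matrix_def)
    ultimately show ?L
      unfolding eigenvalue_def eigenvector_def by metis
  qed
qed

definition digraph_spectral_radius :: "('a, 'b) pre_digraph \<Rightarrow> real" where
  "digraph_spectral_radius D =
     spectral_radius (adjacency_matrix D (SOME vs. distinct vs \<and> set vs = verts D))"

lemma digraph_spectral_radius_eq:
  assumes "distinct vs" and "set vs = verts D"
  shows "digraph_spectral_radius D = spectral_radius (adjacency_matrix D vs)"
proof -
  define ws where "ws = (SOME vs. distinct vs \<and> set vs = verts D)"
  have ws: "distinct ws \<and> set ws = verts D"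
    unfolding ws_def by (rule someI[of _ vs]) (use assms in simp)
  then have "spectrum (adjacency_matrix D ws) = spectrum (adjacency_matrix D vs)"
    unfolding spectrum_def
    by (intro Collect_cong) (simp add: assms eigenvalue_adjacency_matrix_iff)
  then show ?thesis
    unfolding digraph_spectral_radius_def spectral_radius_def ws_def[symmetric] by simp
qed

definition nontrivial_sccs :: "('a, 'b) pre_digraph \<Rightarrow> ('a, 'b) pre_digraph set" where
  "nontrivial_sccs D = {H \<in> pre_digraph.sccs D. 1 < card (verts H)}"

definition essential_cut :: "('a, 'b) pre_digraph \<Rightarrow> 'a set \<Rightarrow> bool" where
  "essential_cut D S \<longleftrightarrow>
     S \<subseteq> verts D \<and> 2 \<le> card (nontrivial_sccs (D \<restriction> (verts D - S)))"

text \<open>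
  The value is \<open>\<infinity>\<close> if no vertex removal leaves two non-trivial strongly connected components,
  for example in a complete digraph.
\<close>

definition essential_connectivity :: "('a, 'b) pre_digraph \<Rightarrow> enat" where
  "essential_connectivity D = (INF S\<in>{S. essential_cut D S}. enat (card S))"

definition ess_conn_digraphs :: "nat \<Rightarrow> nat \<Rightarrow> ('a, 'b) pre_digraph set" where
  "ess_conn_digraphs n k =
     {D. digraph D \<and> strongly_connected D \<and> card (verts D) = n \<and>
         essential_connectivity D = enat k}"

definition complete_pair_digraph :: "'a set \<Rightarrow> 'a pair_pre_digraph" where
  "complete_pair_digraph V = \<lparr> pverts = V, parcs = {(u, v). u \<in> V \<and> v \<in> V \<and> u \<noteq> v} \<rparr>"

text \<open>The next two operations are only meant for arguments with disjoint vertex sets.\<close>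

definition pair_disj_union ::
    "'a pair_pre_digraph \<Rightarrow> 'a pair_pre_digraph \<Rightarrow> 'a pair_pre_digraph" where
  "pair_disj_union G H = \<lparr> pverts = pverts G \<union> pverts H, parcs = parcs G \<union> parcs H \<rparr>"

definition pair_join ::
    "'a pair_pre_digraph \<Rightarrow> 'a pair_pre_digraph \<Rightarrow> 'a pair_pre_digraph" where
  "pair_join G H =
     \<lparr> pverts = pverts G \<union> pverts H,
       parcs = parcs G \<union> parcs H \<union> pverts G \<times> pverts H \<union> pverts H \<times> pverts G \<rparr>"

definition add_parcs :: "'a rel \<Rightarrow> 'a pair_pre_digraph \<Rightarrow> 'a pair_pre_digraph" where
  "add_parcs R G = G \<lparr> parcs := parcs G \<union> R \<rparr>"

text \<open>
  On the vertex set \<open>{0..<n}\<close>, for \<open>2 \<le> m \<le> n - k - 2\<close>: the complete digraphs of orders \<open>k\<close>,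
  \<open>m\<close> and \<open>n - k - m\<close> occupy three consecutive blocks, and all arcs from the second block to
  the third are added.
\<close>

definition extremal_digraph :: "nat \<Rightarrow> nat \<Rightarrow> nat \<Rightarrow> nat pair_pre_digraph" where
  "extremal_digraph n k m =
     add_parcs ({k..<k + m} \<times> {k + m..<n})
       (pair_join (complete_pair_digraph {0..<k})
         (pair_disj_union (complete_pair_digraph {k..<k + m})
           (complete_pair_digraph {k + m..<n})))"

lemma pverts_extremal_digraph:
  "pverts (extremal_digraph n k m) = {0..<k} \<union> {k..<k + m} \<union> {k + m..<n}"
  by (auto simp: extremal_digraph_def add_parcs_def pair_join_def pair_disj_union_def
      complete_pair_digraph_def)

lemma parcs_extremal_digraph:
  assumes "k + m \<le> n"
  shows "(u, v) \<in> parcs (extremal_digraph n k m) \<longleftrightarrow>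
    u < n \<and> v < n \<and> u \<noteq> v \<and> \<not> (k + m \<le> u \<and> k \<le> v \<and> v < k + m)"
  using assms
  by (cases "u < k"; cases "u < k + m"; cases "v < k"; cases "v < k + m")
     (simp_all add: extremal_digraph_def add_parcs_def pair_join_def pair_disj_union_def
      complete_pair_digraph_def)

end

theory Submission
  imports Defs
begin

text \<open>
  Removing an essential cut \<open>K\<close> of order \<open>k\<close> from \<open>D\<close> leaves two non-trivial strong components, one
  of which cannot reach the other; so the remaining vertices split into \<open>A\<close> and \<open>B\<close>, of orders
  \<open>m, l \<ge> 2\<close>, without arcs from \<open>B\<close> to \<open>A\<close>. Hence every out-neighbourhood of \<open>D\<close> is contained in the
  corresponding one of \<open>G\<^sub>n\<close> with parameters \<open>k, m\<close>. The latter digraph has the positive eigenvector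
  with value \<open>\<mu> - l\<close> on \<open>K \<union> A\<close> and \<open>k\<close> on \<open>B\<close> for the eigenvalue \<open>\<mu> - 1\<close>, where \<open>\<mu>\<close> is the larger
  root of \<open>x\<^sup>2 - n x + m l\<close>, and comparison with this vector bounds the spectral radius of \<open>D\<close> by
  \<open>\<mu> - 1\<close>. Finally \<open>\<mu>\<close> is an antitone function of \<open>m l\<close>, which is smallest for \<open>m = 2\<close> or
  \<open>l = 2\<close>.
\<close>

section \<open>Essential cuts\<close>

text \<open>A strong component is determined by its vertex set. Counting can therefore be done on
  \<open>sccs_verts\<close>, whose members are described by mutual reachability.\<close>

lemma card_nontrivial_sccs:
  assumes "wf_digraph G"
  shows "card (nontrivial_sccs G) = card {S \<in> pre_digraph.sccs_verts G. 1 < card S}"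
proof -
  interpret wf_digraph G by fact
  have "{S \<in> sccs_verts. 1 < card S} = verts ` nontrivial_sccs G"
    unfolding sccs_verts_conv nontrivial_sccs_def by auto
  moreover have "inj_on verts (nontrivial_sccs G)"
    using inj_on_verts_sccs by (rule inj_on_subset) (auto simp: nontrivial_sccs_def)
  ultimately show ?thesis
    by (simp add: card_image)
qed

lemma dominates_induce_subgraph_iff:
  "u \<rightarrow>\<^bsub>D \<restriction> T\<^esub> v \<longleftrightarrow> u \<rightarrow>\<^bsub>D\<^esub> v \<and> u \<in> T \<and> v \<in> T"
  by (auto simp: arcs_ends_conv image_iff)

text \<open>Of two distinct components \<open>S\<close> and \<open>T\<close>, one, say
  \<open>T\<close>, cannot reach the other. The set \<open>B\<close> of all vertices reachable from
  \<open>T\<close> is closed under out-arcs, contains \<open>T\<close> and misses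
  \<open>S\<close>.\<close>

lemma (in fin_digraph) split_of_two_nontrivial_sccs:
  assumes "2 \<le> card (nontrivial_sccs G)"
  obtains A B where "verts G = A \<union> B" "A \<inter> B = {}" "2 \<le> card A" "2 \<le> card B"
    "\<And>u v. u \<in> B \<Longrightarrow> v \<in> A \<Longrightarrow> \<not> u \<rightarrow>\<^bsub>G\<^esub> v"
proof -
  have "2 \<le> card {S \<in> sccs_verts. 1 < card S}"
    using assms card_nontrivial_sccs[OF wf_digraph] by simp
  then obtain S T where ST: "S \<in> sccs_verts" "T \<in> sccs_verts" "1 < card S" "1 < card T" "S \<noteq> T"
    by (auto simp: card_le_Suc_iff numeral_2_eq_2)
  note split_thesis = that
  \<comment> \<open>The components are generalised here because it is not known in advance which one
    fails to reach the other; both orders are used at the end.\<close>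
  have split: thesis
    if S: "S \<in> sccs_verts" "1 < card S" and T: "T \<in> sccs_verts" "1 < card T"
      and st: "s \<in> S" "t \<in> T" "\<not> t \<rightarrow>\<^sup>* s" for S T s t
  proof (rule split_thesis)
    define B where "B = {v. t \<rightarrow>\<^sup>* v}"
    define A where "A = verts G - B"
    have B: "B \<subseteq> verts G" unfolding B_def using reachable_in_verts by blast
    then show "verts G = A \<union> B" "A \<inter> B = {}" unfolding A_def by auto
    have fin: "finite A" "finite B" using finite_subset[OF B] by (auto simp: A_def)
    have "T \<subseteq> B" using T(1) st(2) unfolding B_def sccs_verts_def by blast
    then show "2 \<le> card B" using T(2) card_mono[OF fin(2), of T] by linarith
    have "S \<subseteq> A"
    proof
      fix v assume v: "v \<in> S"
      then have "v \<rightarrow>\<^sup>* s" using S(1) st(1) unfolding sccs_verts_def by blast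
      then have "\<not> t \<rightarrow>\<^sup>* v" using st(3) reachable_trans by blast
      then show "v \<in> A" using sccs_verts_subsets[OF S(1)] v unfolding A_def B_def by blast
    qed
    then show "2 \<le> card A" using S(2) card_mono[OF fin(1), of S] by linarith
    show "\<not> u \<rightarrow>\<^bsub>G\<^esub> v" if "u \<in> B" "v \<in> A" for u v
      using that reachable_adj_trans unfolding A_def B_def by blast
  qed
  from ST have "S \<noteq> {}" "T \<noteq> {}" by auto
  then obtain s t where st: "s \<in> S" "t \<in> T" by blast
  have "t \<notin> S" using sccs_verts_disjoint[OF ST(1,2,5)] st by blast
  then have "\<not> s \<rightarrow>\<^sup>* t \<or> \<not> t \<rightarrow>\<^sup>* s"
    using ST(1) st(1) unfolding sccs_verts_def by blast
  then show thesis
    using split[OF ST(1,3,2,4) st] split[OF ST(2,4,1,3) st(2,1)] by blast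
qed

lemma essential_cut_split:
  assumes "fin_digraph D" and "essential_cut D S"
  obtains A B where "verts D - S = A \<union> B" "A \<inter> B = {}" "2 \<le> card A" "2 \<le> card B"
    "\<And>u v. u \<in> B \<Longrightarrow> v \<in> A \<Longrightarrow> \<not> u \<rightarrow>\<^bsub>D\<^esub> v"
proof -
  interpret D: fin_digraph D by fact
  interpret H: fin_digraph "D \<restriction> (verts D - S)"
    by (rule D.fin_digraph_subgraph) (use D.induced_induce in blast)
  have "2 \<le> card (nontrivial_sccs (D \<restriction> (verts D - S)))"
    using assms(2) by (simp add: essential_cut_def)
  then show thesis
  proof (rule H.split_of_two_nontrivial_sccs)
    fix A B
    assume AB: "verts (D \<restriction> (verts D - S)) = A \<union> B" "A \<inter> B = {}" "2 \<le> card A" "2 \<le> card B"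
      and no: "\<And>u v. u \<in> B \<Longrightarrow> v \<in> A \<Longrightarrow> \<not> u \<rightarrow>\<^bsub>D \<restriction> (verts D - S)\<^esub> v"
    show thesis
    proof (rule that)
      show "verts D - S = A \<union> B" using AB(1) by simp
      then show "\<not> u \<rightarrow>\<^bsub>D\<^esub> v" if "u \<in> B" "v \<in> A" for u v
        using no[OF that] that dominates_induce_subgraph_iff[of u v D "verts D - S"] by blast
    qed (fact AB)+
  qed
qed

text \<open>A strongly connected digraph has its whole vertex set as only component. This will bound
  the order of essential cuts of the extremal digraphs from below.\<close>

lemma not_essential_cut_if_strongly_connected:
  assumes "wf_digraph D" and sc: "strongly_connected (D \<restriction> (verts D - S))"
  shows "\<not> essential_cut D S"
proof
  let ?H = "D \<restriction> (verts D - S)"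
  interpret D: wf_digraph D by fact
  interpret H: wf_digraph ?H by (rule D.wellformed_induce_subgraph)
  assume "essential_cut D S"
  then have *: "2 \<le> card {T \<in> H.sccs_verts. 1 < card T}"
    using card_nontrivial_sccs[OF H.wf_digraph] by (simp add: essential_cut_def)
  have "T = verts ?H" if T: "T \<in> H.sccs_verts" for T
  proof -
    obtain u where u: "u \<in> T" using T unfolding H.sccs_verts_def by blast
    have "T \<subseteq> verts ?H" by (rule H.sccs_verts_subsets[OF T])
    then show ?thesis
      using T sc u unfolding strongly_connected_def H.sccs_verts_def by blast
  qed
  then have "{T \<in> H.sccs_verts. 1 < card T} \<subseteq> {verts ?H}" by blast
  then have "card {T \<in> H.sccs_verts. 1 < card T} \<le> 1"
    using card_mono[of "{verts ?H}"] by fastforce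
  with * show False by simp
qed

text \<open>A finite value excludes the empty infimum, which is \<infinity>; a nonempty infimum in
  the well-ordered \<open>enat\<close> is attained.\<close>

lemma essential_connectivity_eq_enat:
  assumes "essential_connectivity D = enat k"
  obtains S where "essential_cut D S" "card S = k"
proof -
  let ?X = "(\<lambda>S. enat (card S)) ` {S. essential_cut D S}"
  have "?X \<noteq> {}"
  proof
    assume "?X = {}"
    then have "Inf ?X = \<infinity>" by (simp only: Inf_empty top_enat_def)
    then show False
      using assms unfolding essential_connectivity_def by simp
  qed
  then have "Inf ?X \<in> ?X"
    by (meson Inf_enat_def wellorder_InfI ex_in_conv)
  then show thesis using assms that unfolding essential_connectivity_def by auto
qed


section \<open>Comparison with a positive vector\<close>

text \<open>Eigenvectors become functions on vertices, so that no later argument depends on an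
  enumeration of the vertices.\<close>

lemma digraph_spectral_radius_cases:
  assumes "finite (verts D)" "verts D \<noteq> {}"
  obtains c f where "digraph_spectral_radius D = norm (c :: complex)" "\<exists>x\<in>verts D. f x \<noteq> 0"
    "\<And>x. x \<in> verts D \<Longrightarrow> (\<Sum>y\<in>verts D. if x \<rightarrow>\<^bsub>D\<^esub> y then f y else 0) = c * f x"
proof -
  obtain vs where vs: "set vs = verts D" "distinct vs"
    using finite_distinct_list[OF assms(1)] by blast
  have "adjacency_matrix D vs \<in> carrier_mat (length vs) (length vs)" "0 < length vs"
    using vs assms(2) by (auto simp: adjacency_matrix_def)
  from spectral_radius_mem_max(1)[OF this] obtain c where
    "eigenvalue (adjacency_matrix D vs) c" "digraph_spectral_radius D = norm c"
    using digraph_spectral_radius_eq[OF vs(2,1)] by (auto simp: spectrum_def)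
  then show thesis
    using that unfolding eigenvalue_adjacency_matrix_iff[OF vs(2)] vs(1) by blast
qed

lemma digraph_spectral_radius_ge_eigenvalue:
  fixes c :: complex
  assumes "finite (verts D)" "\<exists>x\<in>verts D. f x \<noteq> 0"
    "\<And>x. x \<in> verts D \<Longrightarrow> (\<Sum>y\<in>verts D. if x \<rightarrow>\<^bsub>D\<^esub> y then f y else 0) = c * f x"
  shows "norm c \<le> digraph_spectral_radius D"
proof -
  obtain vs where vs: "set vs = verts D" "distinct vs"
    using finite_distinct_list[OF assms(1)] by blast
  have A: "adjacency_matrix D vs \<in> carrier_mat (length vs) (length vs)" "0 < length vs"
    using vs assms(2) by (auto simp: adjacency_matrix_def)
  have "eigenvalue (adjacency_matrix D vs) c"
    unfolding eigenvalue_adjacency_matrix_iff[OF vs(2)] vs(1) using assms(2,3) by blast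
  then show ?thesis
    using spectral_radius_mem_max(2)[OF A, of "norm c"] digraph_spectral_radius_eq[OF vs(2,1)]
    by (auto simp: spectrum_def)
qed

text \<open>A Collatz-Wielandt bound: take an eigenfunction \<open>f\<close> for an eigenvalue of
  maximal modulus and evaluate its equation at a vertex where |f| / w is largest.\<close>

lemma digraph_spectral_radius_le:
  fixes w :: "'a \<Rightarrow> real" and D :: "('a, 'b) pre_digraph"
  assumes fin: "finite (verts D)" and ne: "verts D \<noteq> {}"
    and pos: "\<And>x. x \<in> verts D \<Longrightarrow> 0 < w x"
    and le: "\<And>x. x \<in> verts D \<Longrightarrow> (\<Sum>y\<in>verts D. if x \<rightarrow>\<^bsub>D\<^esub> y then w y else 0) \<le> r * w x"
  shows "digraph_spectral_radius D \<le> r"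
proof -
  obtain c f where c: "digraph_spectral_radius D = norm (c :: complex)" "\<exists>x\<in>verts D. f x \<noteq> 0"
    "\<And>x. x \<in> verts D \<Longrightarrow> (\<Sum>y\<in>verts D. if x \<rightarrow>\<^bsub>D\<^esub> y then f y else 0) = c * f x"
    using digraph_spectral_radius_cases[OF fin ne] by blast
  define M where "M = Max ((\<lambda>x. norm (f x) / w x) ` verts D)"
  have "M \<in> (\<lambda>x. norm (f x) / w x) ` verts D"
    unfolding M_def using fin ne by (intro Max_in) auto
  then obtain x where x: "x \<in> verts D" "M = norm (f x) / w x" by blast
  have M: "norm (f y) \<le> M * w y" if "y \<in> verts D" for y
  proof -
    have "norm (f y) / w y \<le> M" unfolding M_def using fin that by (intro Max_ge) auto
    then show ?thesis using pos[OF that] by (simp add: divide_simps)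
  qed
  have fx: "norm (f x) = M * w x" using x pos[OF x(1)] by simp
  \<comment> \<open>A nonzero value of \<open>f\<close> forces \<open>M\<close> to be positive,
    which allows multiplying \<open>le\<close> by \<open>M\<close> and finally cancelling
    \<open>norm (f x)\<close>.\<close>
  obtain z where z: "z \<in> verts D" "f z \<noteq> 0" using c(2) by blast
  have "0 < norm (f z)" using z by simp
  also have "\<dots> \<le> M * w z" by (rule M[OF z(1)])
  finally have "0 < M" using pos[OF z(1)] by (simp add: zero_less_mult_iff)
  have "norm c * norm (f x) = norm (\<Sum>y\<in>verts D. if x \<rightarrow>\<^bsub>D\<^esub> y then f y else 0)"
    by (simp add: c(3)[OF x(1)] norm_mult)
  also have "\<dots> \<le> (\<Sum>y\<in>verts D. M * (if x \<rightarrow>\<^bsub>D\<^esub> y then w y else 0))"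
    by (rule sum_norm_le) (use M in auto)
  also have "\<dots> = M * (\<Sum>y\<in>verts D. if x \<rightarrow>\<^bsub>D\<^esub> y then w y else 0)"
    by (rule sum_distrib_left[symmetric])
  also have "\<dots> \<le> M * (r * w x)"
    using le[OF x(1)] \<open>0 < M\<close> by simp
  also have "\<dots> = r * norm (f x)" by (simp add: fx)
  finally show ?thesis
    using c(1) fx \<open>0 < M\<close> pos[OF x(1)] by simp
qed

text \<open>The weight is itself an eigenvector for \<open>r\<close>, so \<open>r\<close> is at most
  the spectral radius; the comparison bound gives the converse. This replaces an appeal to
  Perron-Frobenius theory.\<close>

lemma digraph_spectral_radius_eqI:
  fixes w :: "'a \<Rightarrow> real" and D :: "('a, 'b) pre_digraph"
  assumes fin: "finite (verts D)" and ne: "verts D \<noteq> {}"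
    and pos: "\<And>x. x \<in> verts D \<Longrightarrow> 0 < w x"
    and eq: "\<And>x. x \<in> verts D \<Longrightarrow> (\<Sum>y\<in>verts D. if x \<rightarrow>\<^bsub>D\<^esub> y then w y else 0) = r * w x"
  shows "digraph_spectral_radius D = r"
proof (rule antisym)
  show "digraph_spectral_radius D \<le> r"
    using fin ne pos by (rule digraph_spectral_radius_le) (auto simp: eq)
  have "norm (complex_of_real r) \<le> digraph_spectral_radius D"
  proof (rule digraph_spectral_radius_ge_eigenvalue[OF fin])
    show "\<exists>x\<in>verts D. complex_of_real (w x) \<noteq> 0" using ne pos by fastforce
    fix x assume "x \<in> verts D"
    from eq[OF this]
    have "complex_of_real (\<Sum>y\<in>verts D. if x \<rightarrow>\<^bsub>D\<^esub> y then w y else 0) = of_real (r * w x)"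
      by simp
    then show "(\<Sum>y\<in>verts D. if x \<rightarrow>\<^bsub>D\<^esub> y then complex_of_real (w y) else 0) = of_real r * of_real (w x)"
      by (simp add: if_distrib cong: if_cong)
  qed
  then show "r \<le> digraph_spectral_radius D" by simp
qed


section \<open>The Perron vector of three blocks\<close>

text \<open>The larger root of \<open>x\<^sup>2 - n x + p\<close>, meant for \<open>4 p \<le> n\<^sup>2\<close>.\<close>

definition large_root :: "nat \<Rightarrow> nat \<Rightarrow> real" where
  "large_root n p = (real n + sqrt ((real n)\<^sup>2 - 4 * real p)) / 2"

text \<open>\<open>sqrt\<close> is monotone on all reals, so the sign of the discriminant does not
  matter.\<close>

lemma large_root_antimono: "p \<le> q \<Longrightarrow> large_root n q \<le> large_root n p"
  by (simp add: large_root_def)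

text \<open>The equation is the quadratic for \<mu> rearranged into the eigenvector equation at a
  vertex of \<open>K\<close> or \<open>A\<close>, with a loop added. The inequality makes the weight
  \<mu> - l positive.\<close>

lemma large_root_block:
  fixes k m l :: nat and \<mu> :: real
  defines "\<mu> \<equiv> large_root (k + m + l) (m * l)"
  assumes "0 < k" "0 < l"
  shows "\<mu> * (\<mu> - l) = (k + m) * (\<mu> - l) + l * k" and "l < \<mu>"
proof -
  let ?n = "real (k + m + l)"
  \<comment> \<open>The two sides differ by 4 k l: the quadratic takes the value - k l at l, so l
    lies strictly between its roots.\<close>
  have gt: "(2 * real l - ?n)\<^sup>2 < ?n\<^sup>2 - 4 * (real m * real l)"
    using assms(2,3) by (simp add: power2_eq_square algebra_simps)
  then have nonneg: "0 \<le> ?n\<^sup>2 - 4 * (real m * real l)"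
    by (smt (verit) zero_le_power2)
  have "2 * \<mu> - ?n = sqrt (?n\<^sup>2 - 4 * (real m * real l))"
    by (simp add: \<mu>_def large_root_def field_simps)
  then have "(2 * \<mu> - ?n)\<^sup>2 = ?n\<^sup>2 - 4 * (real m * real l)"
    using nonneg by simp
  then show "\<mu> * (\<mu> - l) = (k + m) * (\<mu> - l) + l * k"
    by (simp add: power2_eq_square algebra_simps)
  have "2 * real l - ?n < sqrt (?n\<^sup>2 - 4 * (real m * real l))"
    using gt by (rule real_less_rsqrt)
  then show "l < \<mu>"
    by (simp add: \<mu>_def large_root_def)
qed

text \<open>No digraph is fixed, so the same weights serve both the bound for arbitrary digraphs and
  the exact value for the extremal ones.\<close>

locale three_blocks =
  fixes K A B :: "'a set" and k m l :: nat
  assumes card_K: "card K = k" and card_A: "card A = m" and card_B: "card B = l"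
    and block_pos: "0 < k" "0 < m" "0 < l"
    and disj: "K \<inter> A = {}" "K \<inter> B = {}" "A \<inter> B = {}"
begin

definition \<mu> :: real where "\<mu> = large_root (k + m + l) (m * l)"

text \<open>With loops added, the row equation on \<open>B\<close> reads k x + l y = \<mu> y, where
  x is the value on \<open>K\<close> and \<open>A\<close> and y the value on \<open>B\<close>; hence
  the ratio \<mu> - l to k.\<close>

definition w :: "'a \<Rightarrow> real" where "w v = (if v \<in> B then real k else \<mu> - l)"

text \<open>The largest out-neighbourhood possible without loops and without arcs from
  \<open>B\<close> to \<open>A\<close>; the extremal digraphs attain it.\<close>

definition N :: "'a \<Rightarrow> 'a set" where
  "N u = (if u \<in> B then K \<union> B else K \<union> A \<union> B) - {u}"

lemma finite_blocks: "finite K" "finite A" "finite B"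
  using card_K card_A card_B block_pos by (metis card_gt_0_iff)+

lemma w_pos: "0 < w v"
  using large_root_block(2)[OF block_pos(1,3), of m] block_pos(1) by (simp add: w_def \<mu>_def)

lemma sum_w_blocks:
  "sum w K = k * (\<mu> - l)" "sum w A = m * (\<mu> - l)" "sum w B = l * k"
proof -
  have "sum w K = (\<Sum>v\<in>K. \<mu> - l)" "sum w A = (\<Sum>v\<in>A. \<mu> - l)" "sum w B = (\<Sum>v\<in>B. real k)"
    by (rule sum.cong; use disj in \<open>auto simp: w_def\<close>)+
  then show "sum w K = k * (\<mu> - l)" "sum w A = m * (\<mu> - l)" "sum w B = l * k"
    using card_K card_A card_B by simp_all
qed

text \<open>With \<open>u\<close> included the sum is \<mu> times \<open>w u\<close>, by the choice
  of \<open>w\<close> on \<open>B\<close> and by the quadratic elsewhere; removing \<open>u\<close>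
  shifts the factor by 1.\<close>

lemma sum_w_N:
  assumes u: "u \<in> K \<union> A \<union> B"
  shows "sum w (N u) = (\<mu> - 1) * w u"
proof (cases "u \<in> B")
  case True
  have "sum w (N u) = sum w (K \<union> B) - w u"
    using True finite_blocks by (simp add: N_def sum_diff1)
  also have "sum w (K \<union> B) = \<mu> * k"
    using finite_blocks disj by (simp add: sum.union_disjoint sum_w_blocks algebra_simps)
  finally show ?thesis using True by (simp add: w_def algebra_simps)
next
  case False
  have "sum w (N u) = sum w (K \<union> A \<union> B) - w u"
    using False u finite_blocks by (simp add: N_def sum_diff1)
  also have "sum w (K \<union> A \<union> B) = (k + m) * (\<mu> - l) + l * k"
    using finite_blocks disj
    by (simp add: sum.union_disjoint Int_Un_distrib2 sum_w_blocks algebra_simps)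
  also have "\<dots> = \<mu> * (\<mu> - l)"
    unfolding \<mu>_def by (rule large_root_block(1)[OF block_pos(1,3), symmetric])
  finally show ?thesis using False by (simp add: w_def algebra_simps)
qed

lemma spectral_radius_le:
  assumes V: "verts D = K \<union> A \<union> B" and N: "\<And>u v. u \<rightarrow>\<^bsub>D\<^esub> v \<Longrightarrow> v \<in> N u"
  shows "digraph_spectral_radius D \<le> \<mu> - 1"
proof (rule digraph_spectral_radius_le[where w = w])
  show fin: "finite (verts D)" using V finite_blocks by simp
  show "verts D \<noteq> {}" using V card_K block_pos by auto
  fix x assume "x \<in> verts D"
  have "(\<Sum>y\<in>verts D. if x \<rightarrow>\<^bsub>D\<^esub> y then w y else 0) = sum w (verts D \<inter> {y. x \<rightarrow>\<^bsub>D\<^esub> y})"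
    using fin by (simp add: sum.inter_restrict)
  also have "\<dots> \<le> sum w (N x)"
  proof (rule sum_mono2)
    show "finite (N x)" using finite_blocks by (simp add: N_def)
    show "verts D \<inter> {y. x \<rightarrow>\<^bsub>D\<^esub> y} \<subseteq> N x" using N by blast
  qed (use w_pos less_imp_le in blast)
  also have "\<dots> = (\<mu> - 1) * w x" using sum_w_N \<open>x \<in> verts D\<close> V by simp
  finally show "(\<Sum>y\<in>verts D. if x \<rightarrow>\<^bsub>D\<^esub> y then w y else 0) \<le> (\<mu> - 1) * w x" .
qed (rule w_pos)

lemma spectral_radius_eq:
  assumes V: "verts D = K \<union> A \<union> B"
    and N: "\<And>u v. u \<in> verts D \<Longrightarrow> u \<rightarrow>\<^bsub>D\<^esub> v \<longleftrightarrow> v \<in> N u"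
  shows "digraph_spectral_radius D = \<mu> - 1"
proof (rule digraph_spectral_radius_eqI[where w = w])
  show fin: "finite (verts D)" using V finite_blocks by simp
  show "verts D \<noteq> {}" using V card_K block_pos by auto
  fix x assume x: "x \<in> verts D"
  have "(\<Sum>y\<in>verts D. if x \<rightarrow>\<^bsub>D\<^esub> y then w y else 0) = sum w (verts D \<inter> {y. x \<rightarrow>\<^bsub>D\<^esub> y})"
    using fin by (simp add: sum.inter_restrict)
  also have "verts D \<inter> {y. x \<rightarrow>\<^bsub>D\<^esub> y} = N x" using N[OF x] V by (auto simp: N_def)
  also have "sum w (N x) = (\<mu> - 1) * w x" using sum_w_N x V by simp
  finally show "(\<Sum>y\<in>verts D. if x \<rightarrow>\<^bsub>D\<^esub> y then w y else 0) = (\<mu> - 1) * w x" .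
qed (rule w_pos)

end


section \<open>The extremal digraphs\<close>

lemma verts_extremal_digraph:
  assumes "k + m \<le> n"
  shows "verts (with_proj (extremal_digraph n k m)) = {0..<n}"
  using assms by (auto simp: pverts_extremal_digraph)

lemma digraph_spectral_radius_extremal:
  assumes "0 < k" "0 < m" "k + m < n"
  shows "digraph_spectral_radius (with_proj (extremal_digraph n k m)) =
    large_root n (m * (n - k - m)) - 1"
proof -
  interpret three_blocks "{0..<k}" "{k..<k + m}" "{k + m..<n}" k m "n - k - m"
    by unfold_locales (use assms in auto)
  have "digraph_spectral_radius (with_proj (extremal_digraph n k m)) = \<mu> - 1"
    by (rule spectral_radius_eq)
      (use assms in \<open>auto simp: N_def pverts_extremal_digraph parcs_extremal_digraph\<close>)
  then show ?thesis unfolding \<mu>_def using assms by simp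
qed

text \<open>Vertices of the first block are joined both ways to all others, so every essential cut
  contains that block. Removing exactly this block leaves two complete digraphs with arcs in one
  direction only.\<close>

lemma extremal_digraph_in_ess_conn_digraphs:
  assumes k: "1 \<le> k" and m: "2 \<le> m" and n: "k + m + 2 \<le> n"
  shows "with_proj (extremal_digraph n k m) \<in> ess_conn_digraphs n k"
proof -
  let ?E = "extremal_digraph n k m"
  have kmn: "k + m \<le> n" using n by simp
  have V: "pverts ?E = {0..<n}" using verts_extremal_digraph[OF kmn] by simp
  have arc: "(u, v) \<in> parcs ?E \<longleftrightarrow>
    u < n \<and> v < n \<and> u \<noteq> v \<and> \<not> (k + m \<le> u \<and> k \<le> v \<and> v < k + m)" for u v
    by (rule parcs_extremal_digraph[OF kmn])
  interpret E: pair_digraph ?E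
  proof
    have "parcs ?E \<subseteq> {0..<n} \<times> {0..<n}" by (auto simp: arc)
    then show "finite (parcs ?E)" by (rule finite_subset) simp
  qed (auto simp: V arc)
  have wf: "wf_digraph (with_proj ?E)" by unfold_locales
  have adj: "u \<rightarrow>\<^bsub>with_proj ?E \<restriction> T\<^esub> v \<longleftrightarrow> (u, v) \<in> parcs ?E \<and> u \<in> T \<and> v \<in> T" for u v T
    using dominates_induce_subgraph_iff[of u v "with_proj ?E" T] by simp
  \<comment> \<open>The vertex \<open>h\<close> is a hub of \<open>T\<close>. This is used for the
    whole vertex set and for the complement of a set of fewer than \<open>k\<close>
    vertices.\<close>
  have sc: "strongly_connected (with_proj ?E \<restriction> T)"
    if T: "T \<subseteq> {0..<n}" and h: "h \<in> T" "h < k" for T h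
  proof
    interpret H: wf_digraph "with_proj ?E \<restriction> T" by (rule E.wellformed_induce_subgraph)
    show "verts (with_proj ?E \<restriction> T) \<noteq> {}" using h by auto
    fix u v assume "u \<in> verts (with_proj ?E \<restriction> T)" "v \<in> verts (with_proj ?E \<restriction> T)"
    then have uv: "u \<in> T" "v \<in> T" by simp_all
    have "u \<rightarrow>\<^sup>*\<^bsub>with_proj ?E \<restriction> T\<^esub> h"
    proof (cases "u = h")
      case False
      then have "u \<rightarrow>\<^bsub>with_proj ?E \<restriction> T\<^esub> h" using T h uv by (auto simp: adj arc)
      then show ?thesis by (rule H.reachable_adjI)
    qed (use uv in simp)
    also have "h \<rightarrow>\<^sup>*\<^bsub>with_proj ?E \<restriction> T\<^esub> v"
    proof (cases "v = h")
      case False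
      then have "h \<rightarrow>\<^bsub>with_proj ?E \<restriction> T\<^esub> v" using T h uv by (auto simp: adj arc)
      then show ?thesis by (rule H.reachable_adjI)
    qed (use uv in simp)
    finally (H.reachable_trans) show "u \<rightarrow>\<^sup>*\<^bsub>with_proj ?E \<restriction> T\<^esub> v" .
  qed
  have "strongly_connected (with_proj ?E \<restriction> {0..<n})"
    by (rule sc[of _ 0]) (use k n in auto)
  moreover have "with_proj ?E \<restriction> {0..<n} = with_proj ?E"
    using V by (auto simp: with_proj_def induce_subgraph_def arc)
  ultimately have conn: "strongly_connected (with_proj ?E)" by simp
  have ge: "k \<le> card S" if S: "essential_cut (with_proj ?E) S" for S
  proof (rule ccontr)
    assume "\<not> k \<le> card S"
    moreover have "finite S" using S V by (auto simp: essential_cut_def intro: finite_subset)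
    ultimately have "\<not> {0..<k} \<subseteq> S" by (metis card_atLeastLessThan card_mono diff_zero)
    then obtain h where "h \<notin> S" "h < k" by (auto simp: subset_iff)
    then have "strongly_connected (with_proj ?E \<restriction> (verts (with_proj ?E) - S))"
      using V n by (intro sc[of _ h]) auto
    from not_essential_cut_if_strongly_connected[OF wf this] S show False by simp
  qed
  have cut: "essential_cut (with_proj ?E) {0..<k}"
  proof -
    let ?T = "verts (with_proj ?E) - {0..<k}"
    have T: "?T = {k..<n}" using V by auto
    interpret H: fin_digraph "with_proj ?E \<restriction> ?T"
      by (rule E.fin_digraph_subgraph[OF induced_imp_subgraph[OF E.induced_induce]]) auto
    \<comment> \<open>After the removal, reachability is the reflexive closure of adjacency: at most
      one arc is required, and by \<open>stay\<close> no path leaves the third block.\<close>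
    have step: "u \<rightarrow>\<^sup>*\<^bsub>with_proj ?E \<restriction> ?T\<^esub> v"
      if "u \<in> ?T" "v \<in> ?T" "k + m \<le> u \<longrightarrow> k + m \<le> v" for u v
    proof (cases "u = v")
      case False
      then have "u \<rightarrow>\<^bsub>with_proj ?E \<restriction> ?T\<^esub> v" using that V by (auto simp: adj arc)
      then show ?thesis by (rule H.reachable_adjI)
    qed (use that H.reachable_refl[of v] in simp)
    have stay: "k + m \<le> u \<longrightarrow> k + m \<le> v" if "u \<rightarrow>\<^sup>*\<^bsub>with_proj ?E \<restriction> ?T\<^esub> v" for u v
      using that
    proof (induct rule: H.converse_reachable_induct)
      case (step u w)
      then show ?case unfolding adj arc by auto
    qed simp
    have reach: "u \<rightarrow>\<^sup>*\<^bsub>with_proj ?E \<restriction> ?T\<^esub> v \<longleftrightarrow>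
      u \<in> {k..<n} \<and> v \<in> {k..<n} \<and> (k + m \<le> u \<longrightarrow> k + m \<le> v)" for u v
    proof
      assume uv: "u \<rightarrow>\<^sup>*\<^bsub>with_proj ?E \<restriction> ?T\<^esub> v"
      then have "u \<in> ?T \<and> v \<in> ?T"
        using H.reachable_in_verts[OF uv] by simp
      then show "u \<in> {k..<n} \<and> v \<in> {k..<n} \<and> (k + m \<le> u \<longrightarrow> k + m \<le> v)"
        unfolding T using stay[OF uv] by blast
    next
      assume "u \<in> {k..<n} \<and> v \<in> {k..<n} \<and> (k + m \<le> u \<longrightarrow> k + m \<le> v)"
      then show "u \<rightarrow>\<^sup>*\<^bsub>with_proj ?E \<restriction> ?T\<^esub> v"
        unfolding T by (intro step[unfolded T]) blast+
    qed
    have "{k..<k + m} \<in> H.sccs_verts" "{k + m..<n} \<in> H.sccs_verts"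
      unfolding H.sccs_verts_def reach using m n by auto
    then have "{{k..<k + m}, {k + m..<n}} \<subseteq> {T \<in> H.sccs_verts. 1 < card T}"
      using m n by auto
    moreover have "{k..<k + m} \<noteq> {k + m..<n}" using m n by auto
    ultimately have "2 \<le> card {T \<in> H.sccs_verts. 1 < card T}"
      using H.finite_sccs_verts card_mono[of "{T \<in> H.sccs_verts. 1 < card T}" "{{k..<k + m}, {k + m..<n}}"]
      by simp
    then show ?thesis
      using card_nontrivial_sccs[OF H.wf_digraph] V kmn by (auto simp: essential_cut_def)
  qed
  have "essential_connectivity (with_proj ?E) = enat k"
    unfolding essential_connectivity_def
  proof (rule antisym)
    show "(INF S\<in>{S. essential_cut (with_proj ?E) S}. enat (card S)) \<le> enat k"
      using cut by (intro INF_lower2[of "{0..<k}"]) auto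
    show "enat k \<le> (INF S\<in>{S. essential_cut (with_proj ?E) S}. enat (card S))"
      using ge by (intro INF_greatest) auto
  qed
  moreover have "digraph (with_proj ?E)" by unfold_locales
  ultimately show ?thesis
    using conn V by (simp add: ess_conn_digraphs_def)
qed

section \<open>The upper bound for the whole class, and the conclusion\<close>

lemma spectral_radius_le_extremal:
  assumes k: "1 \<le> k" and D: "D \<in> ess_conn_digraphs n k"
  shows "digraph_spectral_radius D \<le> large_root n (2 * (n - k - 2)) - 1"
proof -
  from D interpret digraph D by (simp add: ess_conn_digraphs_def)
  from D have n: "card (verts D) = n" and "essential_connectivity D = enat k"
    by (simp_all add: ess_conn_digraphs_def)
  then obtain K where cut: "essential_cut D K" and K: "card K = k"
    using essential_connectivity_eq_enat by blast
  obtain A B where AB: "verts D - K = A \<union> B" "A \<inter> B = {}" "2 \<le> card A" "2 \<le> card B"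
    "\<And>u v. u \<in> B \<Longrightarrow> v \<in> A \<Longrightarrow> \<not> u \<rightarrow>\<^bsub>D\<^esub> v"
    using essential_cut_split[OF fin_digraph_axioms cut] by blast
  let ?m = "card A" and ?l = "card B"
  interpret three_blocks K A B k ?m ?l
    by unfold_locales (use AB K k in auto)
  have V: "verts D = K \<union> A \<union> B" using AB(1) cut by (auto simp: essential_cut_def)
  then have sum: "n = k + ?m + ?l"
    using n K finite_blocks disj by (simp add: card_Un_disjoint Int_Un_distrib2)
  have "digraph_spectral_radius D \<le> \<mu> - 1"
  proof (rule spectral_radius_le[OF V])
    fix u v assume uv: "u \<rightarrow>\<^bsub>D\<^esub> v"
    then have "u \<noteq> v" using adj_not_same by blast
    moreover have "v \<in> verts D" using uv by (rule adj_in_verts)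
    ultimately show "v \<in> N u"
      using uv AB(5) V by (auto simp: N_def)
  qed
  also have "\<mu> \<le> large_root n (2 * (n - k - 2))"
  proof -
    \<comment> \<open>In these terms n - k - 2 is 2 + a + b, and the two products differ by a
      b.\<close>
    obtain a b where "?m = 2 + a" "?l = 2 + b" using AB(3,4) le_Suc_ex by metis
    then have "2 * (n - k - 2) \<le> ?m * ?l" by (simp add: sum algebra_simps)
    then show ?thesis unfolding \<mu>_def sum by (rule large_root_antimono)
  qed
  finally show ?thesis by simp
qed

theorem theorem2:
  fixes n k :: nat
  assumes "k \<ge> 1" and "n \<ge> k + 4"
  shows "with_proj (extremal_digraph n k 2) \<in> ess_conn_digraphs n k \<and>
    with_proj (extremal_digraph n k (n - k - 2)) \<in> ess_conn_digraphs n k \<and>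
    digraph_spectral_radius (with_proj (extremal_digraph n k 2)) =
      digraph_spectral_radius (with_proj (extremal_digraph n k (n - k - 2))) \<and>
    (\<forall>D :: ('a, 'b) pre_digraph. D \<in> ess_conn_digraphs n k \<longrightarrow>
      digraph_spectral_radius D \<le> digraph_spectral_radius (with_proj (extremal_digraph n k 2)))"
proof (intro conjI allI impI)
  have rho: "digraph_spectral_radius (with_proj (extremal_digraph n k 2)) =
    large_root n (2 * (n - k - 2)) - 1"
    using digraph_spectral_radius_extremal[of k 2 n] assms by simp
  show "with_proj (extremal_digraph n k 2) \<in> ess_conn_digraphs n k"
    "with_proj (extremal_digraph n k (n - k - 2)) \<in> ess_conn_digraphs n k"
    using assms by (auto intro: extremal_digraph_in_ess_conn_digraphs)
  \<comment> \<open>For m = n - k - 2 the third block has order 2, so the last two block orders are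
    merely exchanged and their product is the same.\<close>
  show "digraph_spectral_radius (with_proj (extremal_digraph n k 2)) =
      digraph_spectral_radius (with_proj (extremal_digraph n k (n - k - 2)))"
    using rho digraph_spectral_radius_extremal[of k "n - k - 2" n] assms
    by (simp add: mult.commute)
  show "digraph_spectral_radius D \<le> digraph_spectral_radius (with_proj (extremal_digraph n k 2))"
    if "D \<in> ess_conn_digraphs n k" for D :: "('a, 'b) pre_digraph"
    using spectral_radius_le_extremal[OF assms(1) that] rho by simp
qed

end
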